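(* Let $X$, $Y$ and $Z$ be compact Hausdorff spaces, let $\mu$ be a stochastic map from $X$ to $Y$ and let $\nu$ be a stochastic map from $Y$ to $Z$. For each $x\in X$, the assignment $$\mathcal{M}_Z\ni E\mapsto(\nu\circ\mu)_x(E):=\int_Y\nu_y(E)\,d\mu_x(y)$$ is a regular probability measure on $Z$. Furthermore, the assignment $X\to\mathrm{ProbMeas}(Z)$, $x\mapsto(\nu\circ\mu)_x$, is a stochastic map from $X$ to $Z$.
   Context: For a compact Hausdorff space $Y$, $\mathcal{M}_Y$ is its Borel $\sigma$-algebra and $\mathrm{ProbMeas}(Y)$ is the set of regular Borel probability measures on $Y$ (outer regular by open sets and inner regular by compact sets on all Borel sets), with the vague topology: the coarsest topology making $\mu\mapsto\int_Y\varphi\,d\mu$ continuous for every continuous $\varphi:Y\to\mathbb{C}$. A (continuous) stochastic map from $X$ to $Y$ is a continuous function $\mu:X\to\mathrm{ProbMeas}(Y)$, with value at $x$ written $\mu_x$. For a stochastic map $\nu$ from $Y$ to $Z$ and $E\in\mathcal{M}_Z$ the function $y\mapsto\nu_y(E)$ is Borel measurable, so the integral makes sense. *)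

theory Defs
  imports "HOL-Probability.Probability"
begin

definition borel_of :: "'a topology \<Rightarrow> 'a measure" where
  "borel_of Y = sigma (topspace Y) {U. openin Y U}"

definition regular_measure :: "'a topology \<Rightarrow> 'a measure \<Rightarrow> bool" where
  "regular_measure Y M \<longleftrightarrow>
     (\<forall>E\<in>sets (borel_of Y).
        emeasure M E = (INF U\<in>{U. openin Y U \<and> E \<subseteq> U}. emeasure M U) \<and>
        emeasure M E = (SUP K\<in>{K. compactin Y K \<and> K \<subseteq> E}. emeasure M K))"

definition ProbMeas :: "'a topology \<Rightarrow> 'a measure set" where
  "ProbMeas Y =
     {M. sets M = sets (borel_of Y) \<and> prob_space M \<and> regular_measure Y M}"

text \<open>
  The initial topology on the regular Borel probability measures for the maps
  integrating a continuous complex-valued function: the preimages of open sets under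
  these maps form a subbase.
\<close>
definition vague_topology :: "'a topology \<Rightarrow> 'a measure topology" where
  "vague_topology Y =
     topology_generated_by
       {{M \<in> ProbMeas Y. (\<integral>y. \<phi> y \<partial>M) \<in> V} |\<phi> V.
          continuous_map Y (euclidean :: complex topology) \<phi> \<and> open V}"

lemma topspace_vague_topology: "topspace (vague_topology Y) = ProbMeas Y"
proof -
  have "\<exists>\<phi> V. ProbMeas Y = {M \<in> ProbMeas Y. (\<integral>y. \<phi> y \<partial>M) \<in> V} \<and>
          continuous_map Y (euclidean :: complex topology) \<phi> \<and> open V"
    by (intro exI[of _ "\<lambda>_. 0"] exI[of _ UNIV]) auto
  then show ?thesis
    unfolding vague_topology_def topology_generated_by_topspace by blast
qed

lemma continuous_map_vague_integral:
  assumes "continuous_map Y (euclidean :: complex topology) \<phi>"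
  shows "continuous_map (vague_topology Y) euclidean (\<lambda>M. \<integral>y. \<phi> y \<partial>M)"
proof -
  have "openin (vague_topology Y) {M \<in> ProbMeas Y. (\<integral>y. \<phi> y \<partial>M) \<in> V}" if "open V" for V
    unfolding vague_topology_def using assms that
    by (intro topology_generated_by_Basis) blast
  then show ?thesis
    by (simp add: continuous_map_def topspace_vague_topology)
qed

lemma vague_topology_coarsest:
  assumes top: "topspace T = ProbMeas Y"
    and cont: "\<And>\<phi>. continuous_map Y (euclidean :: complex topology) \<phi> \<Longrightarrow>
                 continuous_map T euclidean (\<lambda>M. \<integral>y. \<phi> y \<partial>M)"
    and U: "openin (vague_topology Y) U"
  shows "openin T U"
proof -
  have sub: "openin T W"
    if "W \<in> {{M \<in> ProbMeas Y. (\<integral>y. \<phi> y \<partial>M) \<in> V} |\<phi> V.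
          continuous_map Y (euclidean :: complex topology) \<phi> \<and> open V}" for W
    using that cont top by (force simp: continuous_map_def)
  from U have "generate_topology_on {{M \<in> ProbMeas Y. (\<integral>y. \<phi> y \<partial>M) \<in> V} |\<phi> V.
          continuous_map Y (euclidean :: complex topology) \<phi> \<and> open V} U"
    unfolding vague_topology_def by (simp add: openin_topology_generated_by_iff)
  then show ?thesis
    by (induction rule: generate_topology_on.induct) (use sub in auto)
qed

text \<open>
  Only the values on \<^term>\<open>topspace X\<close> matter.
\<close>
definition stochastic_map :: "'a topology \<Rightarrow> 'b topology \<Rightarrow> ('a \<Rightarrow> 'b measure) \<Rightarrow> bool" where
  "stochastic_map X Y \<mu> \<longleftrightarrow> continuous_map X (vague_topology Y) \<mu>"

text \<open>
  By the convention of \<^const>\<open>measure_of\<close>, the result is the zero measure if the set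
  function given by the integral is not a measure; hence a statement about this
  composite should also assert that its values are the integrals.
\<close>
definition stochastic_comp ::
    "'c topology \<Rightarrow> ('b \<Rightarrow> 'c measure) \<Rightarrow> ('a \<Rightarrow> 'b measure) \<Rightarrow> 'a \<Rightarrow> 'c measure" where
  "stochastic_comp Z \<nu> \<mu> x =
     measure_of (topspace Z) (sets (borel_of Z)) (\<lambda>E. \<integral>\<^sup>+y. emeasure (\<nu> y) E \<partial>\<mu> x)"

end

theory Submission
  imports Defs
begin

text \<open>
  The composite is the monadic bind of the Giry monad, so only measurability of \<open>\<nu>\<close>,
  regularity and continuity need an argument. For open \<open>U\<close>, inner regularity and Urysohn's
  lemma exhibit \<open>\<nu>\<^sub>y(U)\<close> as the directed supremum of the integrals \<open>\<integral> f d\<nu>\<^sub>y\<close> over continuous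
  \<open>f\<close> with \<open>0 \<le> f \<le> 1\<^sub>U\<close>. These are continuous in \<open>y\<close>, so \<open>y \<mapsto> \<nu>\<^sub>y(U)\<close> is lower
  semicontinuous, which gives measurability. Integrals against a regular measure commute with
  directed suprema of lower semicontinuous functions, so the composite of \<open>U\<close> is the supremum
  of the integrals of the same \<open>f\<close>; since \<open>{f \<ge> \<epsilon>}\<close> is a compact subset of \<open>U\<close>, the composite
  is inner regular on open sets, hence regular. Continuity in \<open>x\<close> is Fubini's identity
  \<open>\<integral> \<phi> d(\<nu> \<circ> \<mu>)\<^sub>x = \<integral> (\<integral> \<phi> d\<nu>\<^sub>y) d\<mu>\<^sub>x\<close> with a continuous inner integral.
\<close>

section \<open>Borel sets and regular Borel probability measures\<close>

lemma sets_borel_of: "sets (borel_of Y) = sigma_sets (topspace Y) {U. openin Y U}"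
  unfolding borel_of_def by (rule sets_measure_of) (auto dest: openin_subset)

lemma space_borel_of [simp]: "space (borel_of Y) = topspace Y"
  unfolding borel_of_def by (rule space_measure_of) (auto dest: openin_subset)

lemma openin_sets_borel_of: "openin Y U \<Longrightarrow> U \<in> sets (borel_of Y)"
  by (auto simp: sets_borel_of)

lemma closedin_sets_borel_of: "closedin Y C \<Longrightarrow> C \<in> sets (borel_of Y)"
  by (metis closedin_def openin_sets_borel_of sets.compl_sets space_borel_of double_diff
      order_refl)

lemma compactin_sets_borel_of:
  "Hausdorff_space Y \<Longrightarrow> compactin Y K \<Longrightarrow> K \<in> sets (borel_of Y)"
  by (simp add: closedin_sets_borel_of compactin_imp_closedin)

lemma continuous_map_borel_measurable:
  fixes f :: "'a \<Rightarrow> 'b::topological_space"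
  assumes "continuous_map Y euclidean f"
  shows "f \<in> borel_measurable (borel_of Y)"
proof (rule borel_measurableI)
  fix S :: "'b set" assume "open S"
  then have "openin Y {y \<in> topspace Y. f y \<in> S}"
    using assms by (simp add: continuous_map_def)
  moreover have "{y \<in> topspace Y. f y \<in> S} = f -` S \<inter> space (borel_of Y)"
    by auto
  ultimately show "f -` S \<inter> space (borel_of Y) \<in> sets (borel_of Y)"
    by (metis openin_sets_borel_of)
qed

lemma ProbMeasD:
  assumes "M \<in> ProbMeas Y"
  shows "sets M = sets (borel_of Y)" "prob_space M" "regular_measure Y M"
    and "space M = topspace Y"
  using assms sets_eq_imp_space_eq[of M "borel_of Y"] by (auto simp: ProbMeas_def)

lemma stochastic_map_ProbMeas:
  "stochastic_map X Y \<mu> \<Longrightarrow> x \<in> topspace X \<Longrightarrow> \<mu> x \<in> ProbMeas Y"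
  by (auto simp: stochastic_map_def continuous_map_def topspace_vague_topology)

lemma ProbMeas_inner_regular:
  assumes "M \<in> ProbMeas Y" "E \<in> sets M"
  shows "emeasure M E = (SUP K\<in>{K. compactin Y K \<and> K \<subseteq> E}. emeasure M K)"
  using ProbMeasD(1,3)[OF assms(1)] assms(2) unfolding regular_measure_def by blast

section \<open>Regularity from inner regularity on open sets\<close>

text \<open>
  The conclusion is stable under complements and countable unions, so only open sets need
  the hypothesis.
\<close>
lemma closed_open_approx:
  assumes "compact_space Z" "Hausdorff_space Z"
    and sets: "sets M = sets (borel_of Z)" and "finite_measure M"
    and inner: "\<And>U. openin Z U \<Longrightarrow>
      emeasure M U \<le> (SUP K\<in>{K. compactin Z K \<and> K \<subseteq> U}. emeasure M K)"
    and "E \<in> sets (borel_of Z)" "0 < e"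
  shows "\<exists>C U. closedin Z C \<and> openin Z U \<and> C \<subseteq> E \<and> E \<subseteq> U \<and> measure M (U - C) < e"
proof -
  interpret finite_measure M by fact
  have [simp]: "space M = topspace Z"
    using sets_eq_imp_space_eq[OF sets] by simp
  have op: "U \<in> sets M" if "openin Z U" for U
    using that by (simp add: sets openin_sets_borel_of)
  have cl: "C \<in> sets M" if "closedin Z C" for C
    using that by (simp add: sets closedin_sets_borel_of)
  have "E \<in> sigma_sets (topspace Z) {U. openin Z U}"
    using assms(6) by (simp add: sets_borel_of)
  then show ?thesis
    using \<open>0 < e\<close>
  proof (induction arbitrary: e rule: sigma_sets.induct)
    case (Basic U)
    then have U: "openin Z U" by simp
    have ne: "{K. compactin Z K \<and> K \<subseteq> U} \<noteq> {}"
      using compactin_empty by blast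
    have eq: "emeasure M U = (SUP K\<in>{K. compactin Z K \<and> K \<subseteq> U}. emeasure M K)"
      by (intro antisym inner U SUP_least emeasure_mono op) auto
    from SUP_approx_ennreal[OF Basic(2) ne eq] obtain K where K: "compactin Z K" "K \<subseteq> U" "emeasure M U < emeasure M K + e"
      by auto
    have "closedin Z K"
      using K(1) assms(2) by (simp add: compactin_imp_closedin)
    moreover from K(3) have "measure M U < measure M K + e"
      using Basic by (simp add: emeasure_eq_measure ennreal_less_iff flip: ennreal_plus)
    then have "measure M (U - K) < e"
      using op[OF U] cl[OF \<open>closedin Z K\<close>] K(2) by (simp add: finite_measure_Diff)
    ultimately show ?case
      using K(2) U by blast
  next
    case Empty
    then show ?case by (intro exI[of _ "{}"]) auto
  next
    case (Compl A)
    from Compl.IH[OF Compl.prems]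
    obtain C U where CU: "closedin Z C" "openin Z U" "C \<subseteq> A" "A \<subseteq> U"
      "measure M (U - C) < e"
      by blast
    \<comment> \<open>Complementation swaps the roles of the closed and the open set and leaves the
      gap between them unchanged.\<close>
    have "(topspace Z - C) - (topspace Z - U) = U - C"
      using openin_subset[OF CU(2)] by auto
    with CU show ?case
      by (intro exI[of _ "topspace Z - U"] exI[of _ "topspace Z - C"]) auto
  next
    case (Union A)
    \<comment> \<open>Geometric weights of total \<open>e / 2\<close>; the other half of
      \<open>e\<close> pays for cutting the countable union of the \<open>C i\<close> down to a
      finite one.\<close>
    define r where "r i = e / 2 * (1 / 2) ^ Suc i" for i
    have "0 < r i" for i
      using Union by (simp add: r_def)
    then have "\<exists>C U. closedin Z C \<and> openin Z U \<and> C \<subseteq> A i \<and> A i \<subseteq> U \<and> measure M (U - C) < r i" for i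
      using Union.IH by simp
    then obtain C U where CU: "\<And>i. closedin Z (C i)" "\<And>i. openin Z (U i)" "\<And>i. C i \<subseteq> A i"
      "\<And>i. A i \<subseteq> U i" "\<And>i. measure M (U i - C i) < r i"
      by metis
    note [measurable] = cl[OF CU(1)] op[OF CU(2)]
    have r: "r sums (e / 2)"
      using sums_mult[OF power_half_series, of "e / 2"] unfolding r_def by (simp only: mult_1_right)
    have summ: "summable (\<lambda>i. measure M (U i - C i))"
      using sums_summable[OF r] CU(5) by (rule_tac summable_comparison_test'[where N=0])
        (auto intro: less_imp_le)
    have "measure M ((\<Union>i. U i) - (\<Union>i. C i)) \<le> measure M (\<Union>i. U i - C i)"
      by (intro finite_measure_mono) auto
    also have "\<dots> \<le> (\<Sum>i. measure M (U i - C i))"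
      by (intro finite_measure_subadditive_countably summ) auto
    also have "\<dots> \<le> (\<Sum>i. r i)"
      using CU(5) by (intro suminf_le summ sums_summable[OF r]) (auto intro: less_imp_le)
    finally have le: "measure M ((\<Union>i. U i) - (\<Union>i. C i)) \<le> e / 2"
      using sums_unique[OF r] by simp
    \<comment> \<open>The union of all \<open>C i\<close> need not be closed. Its finite partial
      unions are, and their measures converge to that of the whole union.\<close>
    define D where "D n = (\<Union>i<n. C i)" for n
    have Dcl: "closedin Z (D n)" for n
      unfolding D_def using CU(1) by (intro closedin_Union) auto
    note [measurable] = cl[OF Dcl]
    have Dun: "(\<Union>n. D n) = (\<Union>i. C i)"
      by (auto simp: D_def)
    have "(\<lambda>n. measure M (D n)) \<longlonglongrightarrow> measure M (\<Union>n. D n)"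
      by (intro finite_Lim_measure_incseq) (auto simp: incseq_def D_def Bex_def intro: less_le_trans)
    then have "\<forall>\<^sub>F n in sequentially. measure M (\<Union>n. D n) - e / 2 < measure M (D n)"
      by (rule order_tendstoD) (use Union in simp)
    then obtain n where n: "measure M (\<Union>i. C i) - e / 2 < measure M (D n)"
      unfolding Dun by (auto simp: eventually_sequentially)
    have sub: "(\<Union>i. C i) \<subseteq> (\<Union>i. U i)" "D n \<subseteq> (\<Union>i. C i)"
      using CU(3,4) by (blast, auto simp: D_def)
    \<comment> \<open>The gap splits into the gap to the full union of the \<open>C i\<close>, at
      most \<open>e / 2\<close>, and the truncation loss, less than \<open>e / 2\<close>.\<close>
    have "measure M ((\<Union>i. U i) - D n) = measure M (\<Union>i. U i) - measure M (D n)"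
      by (rule finite_measure_Diff) (use sub in auto)
    also have "\<dots> = measure M ((\<Union>i. U i) - (\<Union>i. C i)) + measure M (\<Union>i. C i) - measure M (D n)"
      by (subst finite_measure_Diff) (use sub in auto)
    also have "\<dots> < e"
      using le n by linarith
    finally have "measure M ((\<Union>i. U i) - D n) < e" .
    moreover have "D n \<subseteq> (\<Union>i. A i)" "(\<Union>i. A i) \<subseteq> (\<Union>i. U i)"
      using CU(3,4) unfolding D_def by blast+
    moreover have "openin Z (\<Union>i. U i)"
      using CU(2) by blast
    ultimately show ?case
      using Dcl by (intro exI conjI)
  qed
qed

text \<open>A Borel set lies between a closed and an open set of nearly equal measure, and closed
  subsets of the compact space \<open>Z\<close> are compact. This one squeeze yields outer and inner
  regularity together.\<close>

lemma regular_measureI: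
  assumes "compact_space Z" "Hausdorff_space Z"
    and sets: "sets M = sets (borel_of Z)" and "finite_measure M"
    and inner: "\<And>U. openin Z U \<Longrightarrow>
      emeasure M U \<le> (SUP K\<in>{K. compactin Z K \<and> K \<subseteq> U}. emeasure M K)"
  shows "regular_measure Z M"
  unfolding regular_measure_def
proof (intro ballI conjI antisym)
  interpret finite_measure M by fact
  fix E assume E: "E \<in> sets (borel_of Z)"
  have op: "U \<in> sets M" if "openin Z U" for U
    using that by (simp add: sets openin_sets_borel_of)
  have cl: "C \<in> sets M" if "closedin Z C" for C
    using that by (simp add: sets closedin_sets_borel_of)
  have EM: "E \<in> sets M" using E sets by simp
  have approx: "\<exists>C U. compactin Z C \<and> openin Z U \<and> C \<subseteq> E \<and> E \<subseteq> U \<and>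
      emeasure M U \<le> emeasure M C + ennreal e" if "0 < e" for e
  proof -
    from closed_open_approx[OF assms E that]
    obtain C U where CU: "closedin Z C" "openin Z U" "C \<subseteq> E" "E \<subseteq> U" "measure M (U - C) < e"
      by blast
    have "measure M U = measure M C + measure M (U - C)"
      using CU op cl by (subst finite_measure_Diff) auto
    then have "emeasure M U \<le> emeasure M C + ennreal e"
      using CU(5) that by (simp add: emeasure_eq_measure flip: ennreal_plus)
    with CU closedin_compact_space[OF assms(1)] show ?thesis by blast
  qed
  show "emeasure M E \<le> (INF U\<in>{U. openin Z U \<and> E \<subseteq> U}. emeasure M U)"
    by (intro INF_greatest emeasure_mono) (auto simp: op)
  show "(SUP K\<in>{K. compactin Z K \<and> K \<subseteq> E}. emeasure M K) \<le> emeasure M E"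
    by (intro SUP_least emeasure_mono) (auto simp: EM)
  show "(INF U\<in>{U. openin Z U \<and> E \<subseteq> U}. emeasure M U) \<le> emeasure M E"
  proof (rule ennreal_le_epsilon)
    fix e :: real assume "0 < e"
    from approx[OF this] obtain C U where CU: "openin Z U" "C \<subseteq> E" "E \<subseteq> U"
      "emeasure M U \<le> emeasure M C + ennreal e" by blast
    then have "(INF U\<in>{U. openin Z U \<and> E \<subseteq> U}. emeasure M U) \<le> emeasure M C + ennreal e"
      by (intro INF_lower2[of U]) auto
    also have "\<dots> \<le> emeasure M E + ennreal e"
      by (intro add_right_mono emeasure_mono CU EM)
    finally show "(INF U\<in>{U. openin Z U \<and> E \<subseteq> U}. emeasure M U) \<le> emeasure M E + ennreal e" .
  qed
  show "emeasure M E \<le> (SUP K\<in>{K. compactin Z K \<and> K \<subseteq> E}. emeasure M K)"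
  proof (rule ennreal_le_epsilon)
    fix e :: real assume "0 < e"
    from approx[OF this] obtain C U where CU: "compactin Z C" "openin Z U" "C \<subseteq> E" "E \<subseteq> U"
      "emeasure M U \<le> emeasure M C + ennreal e" by blast
    have "emeasure M E \<le> emeasure M U"
      by (intro emeasure_mono CU op)
    also note CU(5)
    also have "emeasure M C + ennreal e \<le> (SUP K\<in>{K. compactin Z K \<and> K \<subseteq> E}. emeasure M K) + ennreal e"
      by (intro add_right_mono SUP_upper) (use CU in auto)
    finally show "emeasure M E \<le> (SUP K\<in>{K. compactin Z K \<and> K \<subseteq> E}. emeasure M K) + ennreal e" .
  qed
qed

section \<open>Directed suprema under the integral\<close>

text \<open>Used to replace a finite subcover, or a finite choice of indices, by a single index.
  Comparison is restricted to \<open>S\<close> because the functions are uncontrolled outside the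
  space.\<close>

lemma directed_finite_upper_bound:
  assumes "I \<noteq> {}"
    and "\<And>i j. i \<in> I \<Longrightarrow> j \<in> I \<Longrightarrow> \<exists>k\<in>I. \<forall>y\<in>S. g i y \<le> g k y \<and> g j y \<le> (g k y :: 'b::preorder)"
    and "finite A" "A \<subseteq> I"
  shows "\<exists>k\<in>I. \<forall>i\<in>A. \<forall>y\<in>S. g i y \<le> g k y"
  using assms(3,4)
proof (induction A rule: finite_induct)
  case empty
  then show ?case using assms(1) by blast
next
  case (insert a A)
  then obtain k where k: "k \<in> I" "\<forall>i\<in>A. \<forall>y\<in>S. g i y \<le> g k y" by blast
  obtain l where "l \<in> I" "\<forall>y\<in>S. g a y \<le> g l y \<and> g k y \<le> g l y"
    using assms(2)[of a k] insert k by blast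
  then show ?case using k order_trans by (metis insert_iff)
qed

text \<open>
  Directedness alone does not give monotone convergence, as the index set may be uncountable.
  Instead a simple function below the supremum is restricted to compact subsets of its level
  sets; by compactness a single index dominates it there, up to a factor \<open>c < 1\<close>.
\<close>
lemma nn_integral_directed_SUP:
  fixes g :: "'i \<Rightarrow> 'a \<Rightarrow> ennreal"
  assumes "Hausdorff_space Y" and M: "M \<in> ProbMeas Y"
    and ne: "I \<noteq> {}"
    and dir: "\<And>i j. i \<in> I \<Longrightarrow> j \<in> I \<Longrightarrow> \<exists>k\<in>I. \<forall>y\<in>topspace Y. g i y \<le> g k y \<and> g j y \<le> g k y"
    and lsc: "\<And>i t. i \<in> I \<Longrightarrow> openin Y {y \<in> topspace Y. t < g i y}"
  shows "(\<integral>\<^sup>+y. (SUP i\<in>I. g i y) \<partial>M) = (SUP i\<in>I. \<integral>\<^sup>+y. g i y \<partial>M)"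
proof (rule antisym)
  note [simp] = ProbMeasD(4)[OF M]
  interpret prob_space M using ProbMeasD(2)[OF M] .
  have meas: "K \<in> sets M" if "compactin Y K" for K
    using that assms(1) ProbMeasD(1)[OF M] by (simp add: compactin_sets_borel_of)
  show "(SUP i\<in>I. \<integral>\<^sup>+y. g i y \<partial>M) \<le> (\<integral>\<^sup>+y. (SUP i\<in>I. g i y) \<partial>M)"
    by (intro SUP_least nn_integral_mono SUP_upper)
  show "(\<integral>\<^sup>+y. (SUP i\<in>I. g i y) \<partial>M) \<le> (SUP i\<in>I. \<integral>\<^sup>+y. g i y \<partial>M)"
    \<comment> \<open>Simple functions with values below \<open>top\<close> suffice. Finiteness
      makes \<open>c * v < v\<close> strict for nonzero \<open>v\<close>, and later lets
      multiplication by \<open>c * v\<close> pass to the limit.\<close>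
    unfolding nn_integral_def_finite[of _ "\<lambda>y. SUP i\<in>I. g i y"]
  proof (safe intro!: SUP_least)
    fix s assume s: "simple_function M s" "s \<le> (\<lambda>y. SUP i\<in>I. g i y)" "\<forall>y. s y < top"
    define V where "V = s ` topspace Y"
    define A where "A v = s -` {v} \<inter> topspace Y" for v
    have V: "finite V"
      using s(1) by (simp add: V_def simple_function_def)
    have A: "A v \<in> sets M" for v
      using simple_functionD(2)[OF s(1), of "{v}"] by (simp add: A_def)
    have "\<exists>k\<in>I. \<forall>y\<in>K. c * v \<le> g k y"
      if c: "0 < c" "c < 1" and v: "v \<in> V" and K: "compactin Y K" "K \<subseteq> A v" for c v K
    proof (cases "v = 0")
      case False
      have "v < top" using v s(3) by (auto simp: V_def)
      then have cv: "c * v < v"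
        using ennreal_mult_strict_right_mono[of c 1 v] c False by (simp add: zero_less_iff_neq_zero)
      \<comment> \<open>On \<open>K\<close> the supremum is at least \<open>v > c * v\<close>, so
        these sets, open by semicontinuity, cover \<open>K\<close>. Directedness turns a finite
        subcover into one index.\<close>
      let ?G = "\<lambda>i. {y \<in> topspace Y. c * v < g i y}"
      have "K \<subseteq> \<Union>(?G ` I)"
      proof
        fix y assume y: "y \<in> K"
        then have "s y = v" "y \<in> topspace Y" using K(2) by (auto simp: A_def)
        then have "c * v < (SUP i\<in>I. g i y)"
          using cv s(2) by (metis le_funD order_less_le_trans)
        then show "y \<in> \<Union>(?G ` I)"
          using \<open>y \<in> topspace Y\<close> by (auto simp: less_SUP_iff)
      qed
      moreover have "\<forall>U\<in>?G ` I. openin Y U" using lsc by auto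
      ultimately obtain F where F: "finite F" "F \<subseteq> ?G ` I" "K \<subseteq> \<Union>F"
        using K(1) unfolding compactin_def by meson
      then obtain J where J: "J \<subseteq> I" "finite J" "F = ?G ` J"
        by (meson finite_subset_image)
      obtain k where "k \<in> I" "\<forall>i\<in>J. \<forall>y\<in>topspace Y. g i y \<le> g k y"
        using directed_finite_upper_bound[of I "topspace Y" g J] ne dir J by blast
      moreover have "c * v \<le> g k y" if y: "y \<in> K" for y
      proof -
        obtain i where "i \<in> J" "y \<in> topspace Y" "c * v < g i y"
          using F(3) J(3) y by blast
        then show ?thesis
          using \<open>\<forall>i\<in>J. \<forall>y\<in>topspace Y. g i y \<le> g k y\<close> by (meson less_imp_le order_trans)
      qed
      ultimately show ?thesis by blast
    qed (use ne in auto)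
    note ex = this
    have approx: "(\<Sum>v\<in>V. c * v * emeasure M (K v)) \<le> (SUP i\<in>I. \<integral>\<^sup>+y. g i y \<partial>M)"
      if c: "0 < c" "c < 1" and K: "\<And>v. v \<in> V \<Longrightarrow> compactin Y (K v) \<and> K v \<subseteq> A v" for c K
    proof -
      from ex[OF c] K have "\<forall>v\<in>V. \<exists>k\<in>I. \<forall>y\<in>K v. c * v \<le> g k y" by blast
      then obtain j where j: "\<forall>v\<in>V. j v \<in> I \<and> (\<forall>y\<in>K v. c * v \<le> g (j v) y)" by metis
      obtain k where k: "k \<in> I" "\<forall>i\<in>j ` V. \<forall>y\<in>topspace Y. g i y \<le> g k y"
        using directed_finite_upper_bound[of I "topspace Y" g "j ` V"] ne dir V j by blast
      have "(\<Sum>v\<in>V. c * v * emeasure M (K v)) = (\<integral>\<^sup>+y. (\<Sum>v\<in>V. c * v * indicator (K v) y) \<partial>M)"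
        using K meas by (subst nn_integral_sum) (auto simp: nn_integral_cmult)
      also have "\<dots> \<le> (\<integral>\<^sup>+y. g k y \<partial>M)"
      proof (rule nn_integral_mono)
        fix y assume "y \<in> space M"
        then have y: "y \<in> topspace Y" by simp
        \<comment> \<open>The level sets \<open>A v\<close> are disjoint, so at \<open>y\<close>
          only the term with \<open>v = s y\<close> can be nonzero.\<close>
        have "(\<Sum>v\<in>V. c * v * indicator (K v) y) = (\<Sum>v\<in>{s y}. c * v * indicator (K v) y)"
        proof (intro sum.mono_neutral_right V ballI)
          fix v assume v: "v \<in> V - {s y}"
          then have "K v \<subseteq> s -` {v}" using K by (auto simp: A_def)
          with v have "y \<notin> K v" by auto
          then show "c * v * indicator (K v) y = 0" by simp
        qed (use y in \<open>auto simp: V_def\<close>)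
        also have "\<dots> \<le> g k y"
        proof (cases "y \<in> K (s y)")
          case True
          moreover have "s y \<in> V" using y by (simp add: V_def)
          ultimately have "c * s y \<le> g (j (s y)) y" "g (j (s y)) y \<le> g k y"
            using j k(2) y by blast+
          then show ?thesis using True by simp
        qed simp
        finally show "(\<Sum>v\<in>V. c * v * indicator (K v) y) \<le> g k y" .
      qed
      also have "\<dots> \<le> (SUP i\<in>I. \<integral>\<^sup>+y. g i y \<partial>M)"
        using k by (intro SUP_upper)
      finally show ?thesis .
    qed
    \<comment> \<open>Inner regularity gives a supremum over a possibly uncountable family of
      compact sets; a sequence attaining it allows a limit inside the finite sum over
      \<open>V\<close>.\<close>
    have "\<exists>K. (\<forall>n. compactin Y (K n) \<and> K n \<subseteq> A v) \<and> (\<lambda>n. emeasure M (K n)) \<longlonglongrightarrow> emeasure M (A v)" for v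
    proof -
      let ?S = "{K. compactin Y K \<and> K \<subseteq> A v}"
      have "emeasure M ` ?S \<noteq> {}" using compactin_empty by blast
      from ennreal_Sup_countable_SUP[OF this]
      obtain f where f: "incseq f" "range f \<subseteq> emeasure M ` ?S" "Sup (emeasure M ` ?S) = (SUP n. f n)"
        by auto
      have "\<forall>n. \<exists>K. K \<in> ?S \<and> f n = emeasure M K"
        using f(2) by blast
      then obtain K where K: "\<forall>n. K n \<in> ?S \<and> f n = emeasure M (K n)"
        by (rule choice[THEN exE])
      have "emeasure M (A v) = Sup (emeasure M ` ?S)"
        using ProbMeas_inner_regular[OF M A] .
      then have "f \<longlonglongrightarrow> emeasure M (A v)" using LIMSEQ_SUP[OF f(1)] f(3) by simp
      moreover have "f = (\<lambda>n. emeasure M (K n))" using K by auto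
      ultimately show ?thesis using K by (intro exI[of _ K]) simp
    qed
    then obtain K where K: "\<And>v n. compactin Y (K v n) \<and> K v n \<subseteq> A v"
      "\<And>v. (\<lambda>n. emeasure M (K v n)) \<longlonglongrightarrow> emeasure M (A v)" by metis
    show "integral\<^sup>S M s \<le> (SUP i\<in>I. \<integral>\<^sup>+y. g i y \<partial>M)"
    \<comment> \<open>Two limits in turn: the compact sets exhaust the level sets for fixed
      \<open>c\<close>, then \<open>c\<close> tends to 1.\<close>
    proof (rule ennreal_approx_unit)
      fix c :: ennreal assume c: "0 < c" "c < 1"
      have "(\<lambda>n. \<Sum>v\<in>V. c * v * emeasure M (K v n)) \<longlonglongrightarrow> (\<Sum>v\<in>V. c * v * emeasure M (A v))"
      proof (intro tendsto_sum ennreal_tendsto_cmult K)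
        fix v assume "v \<in> V"
        then have "v < top" using s(3) by (auto simp: V_def)
        then show "c * v < top" using c by (simp add: ennreal_mult_less_top order_less_trans)
      qed
      then have "(\<Sum>v\<in>V. c * v * emeasure M (A v)) \<le> (SUP i\<in>I. \<integral>\<^sup>+y. g i y \<partial>M)"
        by (rule LIMSEQ_le_const2) (intro exI allI impI approx[OF c] K(1))
      then show "c * integral\<^sup>S M s \<le> (SUP i\<in>I. \<integral>\<^sup>+y. g i y \<partial>M)"
        by (simp add: simple_integral_def V_def A_def sum_distrib_left mult.assoc)
    qed
  qed
qed

section \<open>Continuous functions below the indicator of an open set\<close>

lemma Urysohn_compact_open:
  assumes "compact_space Z" "Hausdorff_space Z" "compactin Z K" "openin Z U" "K \<subseteq> U"
  obtains f where "continuous_map Z euclideanreal f" "\<And>z. z \<in> topspace Z \<Longrightarrow> 0 \<le> f z \<and> f z \<le> 1"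
    "\<And>z. z \<in> K \<Longrightarrow> f z = 1" "\<And>z. z \<in> topspace Z - U \<Longrightarrow> f z = 0"
proof -
  have "normal_space Z"
    using assms(1,2) by (simp add: compact_Hausdorff_or_regular_imp_normal_space)
  moreover have "closedin Z (topspace Z - U)" "closedin Z K"
    using assms by (auto simp: compactin_imp_closedin)
  moreover have "disjnt (topspace Z - U) K" using assms(5) by (auto simp: disjnt_def)
  ultimately obtain f where f: "continuous_map Z (top_of_set {0..1::real}) f"
    "f ` (topspace Z - U) \<subseteq> {0}" "f ` K \<subseteq> {1}"
    using Urysohn_lemma[of Z "topspace Z - U" K 0 1] by auto
  show ?thesis
    using f by (intro that[of f]) (auto simp: continuous_map_in_subtopology image_subset_iff)
qed

text \<open>The bound by the indicator encodes both \<open>f \<le> 1\<close> and vanishing off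
  \<open>U\<close>. No condition is put on the closed support, which keeps the family closed under
  \<open>max\<close> and still makes each level set above a positive number a closed subset of
  \<open>U\<close>.\<close>

definition open_minorants :: "'a topology \<Rightarrow> 'a set \<Rightarrow> ('a \<Rightarrow> real) set" where
  "open_minorants Z U = {f. continuous_map Z euclideanreal f \<and>
     (\<forall>z\<in>topspace Z. 0 \<le> f z \<and> f z \<le> indicator U z)}"

lemma open_minorants_measurable:
  assumes "sets M = sets (borel_of Z)" "f \<in> open_minorants Z U"
  shows "f \<in> borel_measurable M"
  using assms continuous_map_borel_measurable[of Z f]
  by (auto simp: open_minorants_def cong: measurable_cong_sets)

text \<open>For compact \<open>K\<close> inside \<open>U\<close>, a Urysohn function lies between
  the indicators of \<open>K\<close> and \<open>U\<close>, so its integral is at least the measure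
  of \<open>K\<close>; inner regularity then gives the nontrivial inequality.\<close>

lemma emeasure_open_eq_SUP_minorants:
  assumes "compact_space Z" "Hausdorff_space Z" and N: "N \<in> ProbMeas Z" and U: "openin Z U"
  shows "emeasure N U = (SUP f\<in>open_minorants Z U. \<integral>\<^sup>+z. ennreal (f z) \<partial>N)"
proof (rule antisym)
  note N' = ProbMeasD[OF N]
  have UN: "U \<in> sets N" using U N'(1) by (simp add: openin_sets_borel_of)
  have "emeasure N U = (SUP K\<in>{K. compactin Z K \<and> K \<subseteq> U}. emeasure N K)"
    using ProbMeas_inner_regular[OF N UN] .
  also have "\<dots> \<le> (SUP f\<in>open_minorants Z U. \<integral>\<^sup>+z. ennreal (f z) \<partial>N)"
  proof (safe intro!: SUP_least)
    fix K assume K: "compactin Z K" "K \<subseteq> U"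
    obtain f where f: "continuous_map Z euclideanreal f"
      "\<And>z. z \<in> topspace Z \<Longrightarrow> 0 \<le> f z \<and> f z \<le> 1"
      "\<And>z. z \<in> K \<Longrightarrow> f z = 1" "\<And>z. z \<in> topspace Z - U \<Longrightarrow> f z = 0"
      using Urysohn_compact_open[OF assms(1,2) K(1) U K(2)] by blast
    have "f \<in> open_minorants Z U"
      unfolding open_minorants_def using f(1,2,4) by (auto simp: indicator_def)
    moreover have "emeasure N K \<le> (\<integral>\<^sup>+z. ennreal (f z) \<partial>N)"
    proof -
      have "K \<in> sets N" using K N'(1) assms(2) by (simp add: compactin_sets_borel_of)
      then have "emeasure N K = (\<integral>\<^sup>+z. indicator K z \<partial>N)" by simp
      also have "\<dots> \<le> (\<integral>\<^sup>+z. ennreal (f z) \<partial>N)"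
        using f(3) by (intro nn_integral_mono) (simp add: indicator_def)
      finally show ?thesis .
    qed
    ultimately show "emeasure N K \<le> (SUP f\<in>open_minorants Z U. \<integral>\<^sup>+z. ennreal (f z) \<partial>N)"
      by (intro SUP_upper2[of f])
  qed
  finally show "emeasure N U \<le> (SUP f\<in>open_minorants Z U. \<integral>\<^sup>+z. ennreal (f z) \<partial>N)" .
  show "(SUP f\<in>open_minorants Z U. \<integral>\<^sup>+z. ennreal (f z) \<partial>N) \<le> emeasure N U"
  proof (rule SUP_least)
    fix f assume f: "f \<in> open_minorants Z U"
    have "(\<integral>\<^sup>+z. ennreal (f z) \<partial>N) \<le> (\<integral>\<^sup>+z. indicator U z \<partial>N)"
      using f N'(4) by (intro nn_integral_mono)
        (auto simp: open_minorants_def indicator_def split: if_splits)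
    then show "(\<integral>\<^sup>+z. ennreal (f z) \<partial>N) \<le> emeasure N U" using UN by simp
  qed
qed

lemma open_minorants_nonempty: "open_minorants Z U \<noteq> {}"
proof -
  have "(\<lambda>_. 0) \<in> open_minorants Z U" by (simp add: open_minorants_def)
  then show ?thesis by blast
qed

text \<open>Makes the family of minorants directed, as required by
  \<open>nn_integral_directed_SUP\<close>.\<close>

lemma open_minorants_max:
  "f \<in> open_minorants Z U \<Longrightarrow> g \<in> open_minorants Z U \<Longrightarrow> (\<lambda>z. max (f z) (g z)) \<in> open_minorants Z U"
  by (auto simp: open_minorants_def le_max_iff_disj intro!: continuous_map_real_max)

section \<open>Continuity, semicontinuity and measurability of stochastic maps\<close>

lemma continuous_map_bounded_compact:
  fixes f :: "'a \<Rightarrow> 'b::metric_space"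
  assumes "compact_space Z" "continuous_map Z euclidean f"
  shows "bounded (f ` topspace Z)"
  using image_compactin[of Z "topspace Z" euclidean f] assms
  by (simp add: compact_space_def compact_imp_bounded)

lemma integrable_continuous_map:
  fixes f :: "'a \<Rightarrow> 'b::{banach,second_countable_topology}"
  assumes "compact_space Z" "continuous_map Z euclidean f" "N \<in> ProbMeas Z"
  shows "integrable N f"
proof -
  note N = ProbMeasD[OF assms(3)]
  interpret prob_space N by fact
  obtain B where "\<And>z. z \<in> topspace Z \<Longrightarrow> norm (f z) \<le> B"
    using continuous_map_bounded_compact[OF assms(1,2)] by (auto simp: bounded_iff)
  then show ?thesis
    using continuous_map_borel_measurable[OF assms(2)] N
    by (intro integrable_const_bound[of _ B]) (auto cong: measurable_cong_sets)
qed

lemma stochastic_map_integral_continuous: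
  assumes "stochastic_map Y Z \<nu>" "continuous_map Z (euclidean :: complex topology) \<phi>"
  shows "continuous_map Y euclidean (\<lambda>y. \<integral>z. \<phi> z \<partial>\<nu> y)"
  using continuous_map_compose[OF _ continuous_map_vague_integral[OF assms(2)]] assms(1)
  by (auto simp: stochastic_map_def o_def)

text \<open>The vague topology is defined by complex test functions, so \<open>f\<close> is embedded
  into the complex numbers and the result recovered with \<open>Re\<close>.\<close>

lemma stochastic_map_real_integral_continuous:
  assumes "stochastic_map Y Z \<nu>" "continuous_map Z euclideanreal f"
  shows "continuous_map Y euclideanreal (\<lambda>y. \<integral>z. f z \<partial>\<nu> y)"
proof -
  have "continuous_map Z euclidean (\<lambda>z. complex_of_real (f z))"
    using continuous_map_compose[OF assms(2), of euclidean complex_of_real]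
    by (simp add: o_def continuous_map_iff_continuous2 continuous_intros)
  from stochastic_map_integral_continuous[OF assms(1) this]
  have "continuous_map Y euclidean (\<lambda>y. complex_of_real (\<integral>z. f z \<partial>\<nu> y))"
    by simp
  from continuous_map_compose[OF this, of euclidean Re]
  show ?thesis by (simp add: o_def continuous_map_iff_continuous2 continuous_intros)
qed

text \<open>For a nonnegative integrable \<open>f\<close> the extended integral is
  \<open>ennreal\<close> of the Bochner integral, which is continuous in \<open>y\<close>.\<close>

lemma stochastic_map_nn_integral_lsc:
  assumes "compact_space Z" "stochastic_map Y Z \<nu>" "f \<in> open_minorants Z U"
  shows "openin Y {y \<in> topspace Y. t < (\<integral>\<^sup>+z. ennreal (f z) \<partial>\<nu> y)}"
proof -
  have f: "continuous_map Z euclideanreal f" "\<And>z. z \<in> topspace Z \<Longrightarrow> 0 \<le> f z"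
    using assms(3) by (auto simp: open_minorants_def)
  have "(\<integral>\<^sup>+z. ennreal (f z) \<partial>\<nu> y) = ennreal (\<integral>z. f z \<partial>\<nu> y)" if "y \<in> topspace Y" for y
  proof (rule nn_integral_eq_integral)
    note N = stochastic_map_ProbMeas[OF assms(2) that]
    show "integrable (\<nu> y) f" by (rule integrable_continuous_map[OF assms(1) f(1) N])
    show "AE z in \<nu> y. 0 \<le> f z" using f(2) ProbMeasD(4)[OF N] by (intro AE_I2) simp
  qed
  then have "{y \<in> topspace Y. t < (\<integral>\<^sup>+z. ennreal (f z) \<partial>\<nu> y)} =
      {y \<in> topspace Y. (\<integral>z. f z \<partial>\<nu> y) \<in> {r. t < ennreal r}}"
    by auto
  moreover have "open {r. t < ennreal r}"
    using continuous_on_ennreal[of UNIV "\<lambda>r. r"] by (intro open_Collect_less continuous_intros) simp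
  ultimately show ?thesis
    using openin_continuous_map_preimage
        [OF stochastic_map_real_integral_continuous[OF assms(2) f(1)], of "{r. t < ennreal r}"]
    by simp
qed

text \<open>A supremum exceeds \<open>t\<close> exactly when some member does, so the set is a
  union, over all minorants, of open sets.\<close>

lemma stochastic_map_emeasure_open_lsc:
  assumes "compact_space Z" "Hausdorff_space Z" "stochastic_map Y Z \<nu>" "openin Z U"
  shows "openin Y {y \<in> topspace Y. t < emeasure (\<nu> y) U}"
proof -
  have "{y \<in> topspace Y. t < emeasure (\<nu> y) U} =
      (\<Union>f\<in>open_minorants Z U. {y \<in> topspace Y. t < (\<integral>\<^sup>+z. ennreal (f z) \<partial>\<nu> y)})"
    using emeasure_open_eq_SUP_minorants[OF assms(1,2) _ assms(4)]
      stochastic_map_ProbMeas[OF assms(3)] by (auto simp: less_SUP_iff)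
  then show ?thesis
    using stochastic_map_nn_integral_lsc[OF assms(1,3)] by auto
qed

text \<open>Open sets form an intersection-stable generator, so measurability need only be tested on
  them, where semicontinuity gives it. This makes the Giry bind available.\<close>

lemma stochastic_map_measurable:
  assumes "compact_space Z" "Hausdorff_space Z" "stochastic_map Y Z \<nu>"
  shows "\<nu> \<in> measurable (borel_of Y) (subprob_algebra (borel_of Z))"
proof (rule measurable_subprob_algebra_generated[OF sets_borel_of])
  show "Int_stable {U. openin Z U}" by (auto simp: Int_stable_def)
  show "{U. openin Z U} \<subseteq> Pow (topspace Z)" by (auto dest: openin_subset)
  note P = ProbMeasD[OF stochastic_map_ProbMeas[OF assms(3)]]
  show "subprob_space (\<nu> y)" if "y \<in> space (borel_of Y)" for y
    using P(2) that by (simp add: prob_space_imp_subprob_space)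
  show "sets (\<nu> y) = sets (borel_of Z)" if "y \<in> space (borel_of Y)" for y
    using P(1) that by simp
  show "(\<lambda>y. emeasure (\<nu> y) U) \<in> borel_measurable (borel_of Y)" if "U \<in> {U. openin Z U}" for U
    using stochastic_map_emeasure_open_lsc[OF assms] that
    by (intro borel_measurableI_greater) (simp add: openin_sets_borel_of)
  then show "(\<lambda>y. emeasure (\<nu> y) (topspace Z)) \<in> borel_measurable (borel_of Y)"
    by simp
qed

lemma stochastic_map_measurable':
  assumes "compact_space Z" "Hausdorff_space Z" "stochastic_map Y Z \<nu>" "M \<in> ProbMeas Y"
  shows "\<nu> \<in> measurable M (subprob_algebra (borel_of Z))"
  using stochastic_map_measurable[OF assms(1-3)] ProbMeasD(1)[OF assms(4)]
  by (simp cong: measurable_cong_sets)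

section \<open>Regularity of the bind\<close>

lemma bind_stochastic_map_ProbMeas:
  assumes "Hausdorff_space Y" "compact_space Z" "Hausdorff_space Z"
    and \<nu>: "stochastic_map Y Z \<nu>" and M: "M \<in> ProbMeas Y"
  shows "M \<bind> \<nu> \<in> ProbMeas Z"
proof -
  note M' = ProbMeasD[OF M]
  note [measurable] = stochastic_map_measurable'[OF assms(2,3) \<nu> M]
  note P = ProbMeasD[OF stochastic_map_ProbMeas[OF \<nu>]]
  interpret M: prob_space M by fact
  let ?L = "M \<bind> \<nu>"
  have L: "prob_space ?L"
    by (rule M.prob_space_bind[where S="borel_of Z"]) (use P(2) M'(4) in auto)
  interpret L: prob_space ?L by fact
  have sets: "sets ?L = sets (borel_of Z)"
    using P(1) M'(4) M.not_empty by (intro sets_bind) auto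
  have sp: "space ?L = topspace Z"
    using sets_eq_imp_space_eq[OF sets] by simp
  have "emeasure ?L U \<le> (SUP K\<in>{K. compactin Z K \<and> K \<subseteq> U}. emeasure ?L K)"
    if U: "openin Z U" for U
  proof -
    let ?I = "open_minorants Z U"
    have "emeasure ?L U = (\<integral>\<^sup>+y. emeasure (\<nu> y) U \<partial>M)"
      using M.not_empty U by (intro emeasure_bind[where N="borel_of Z"])
        (auto simp: openin_sets_borel_of)
    also have "\<dots> = (\<integral>\<^sup>+y. (SUP f\<in>?I. \<integral>\<^sup>+z. ennreal (f z) \<partial>\<nu> y) \<partial>M)"
      using emeasure_open_eq_SUP_minorants[OF assms(2,3) stochastic_map_ProbMeas[OF \<nu>] U] M'(4)
      by (intro nn_integral_cong) simp
    also have "\<dots> = (SUP f\<in>?I. \<integral>\<^sup>+y. (\<integral>\<^sup>+z. ennreal (f z) \<partial>\<nu> y) \<partial>M)"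
    proof (rule nn_integral_directed_SUP[OF assms(1) M open_minorants_nonempty])
      fix f g assume "f \<in> ?I" "g \<in> ?I"
      then show "\<exists>k\<in>?I. \<forall>y\<in>topspace Y. (\<integral>\<^sup>+z. ennreal (f z) \<partial>\<nu> y) \<le> (\<integral>\<^sup>+z. ennreal (k z) \<partial>\<nu> y) \<and>
          (\<integral>\<^sup>+z. ennreal (g z) \<partial>\<nu> y) \<le> (\<integral>\<^sup>+z. ennreal (k z) \<partial>\<nu> y)"
        by (intro bexI[OF _ open_minorants_max[of f Z U g]] ballI conjI nn_integral_mono ennreal_leI) auto
    qed (rule stochastic_map_nn_integral_lsc[OF assms(2) \<nu>])
    \<comment> \<open>After the exchange of supremum and integral, each iterated integral becomes an
      integral against the bind.\<close>
    also have "\<dots> = (SUP f\<in>?I. \<integral>\<^sup>+z. ennreal (f z) \<partial>?L)"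
      by (intro SUP_cong refl nn_integral_bind[symmetric, where B="borel_of Z"])
        (auto intro!: measurable_compose[OF open_minorants_measurable[OF refl]])
    also have "\<dots> \<le> (SUP K\<in>{K. compactin Z K \<and> K \<subseteq> U}. emeasure ?L K)"
    proof (rule SUP_least, rule ennreal_le_epsilon)
      fix f and e :: real assume f: "f \<in> ?I" and "0 < e"
      define K where "K = {z \<in> topspace Z. e \<le> f z}"
      have "closedin Z {z \<in> topspace Z. f z \<in> {e..}}"
        using closedin_continuous_map_preimage[of Z euclideanreal f "{e..}"] f
        by (simp add: open_minorants_def)
      then have clK: "closedin Z K" by (simp add: K_def)
      then have KL: "K \<in> sets ?L" by (simp add: sets closedin_sets_borel_of)
      have "compactin Z K" using clK assms(2) by (simp add: closedin_compact_space)
      moreover have "K \<subseteq> U"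
      proof (rule subsetI, rule ccontr)
        fix z assume "z \<in> K" "z \<notin> U"
        then have "e \<le> f z" "f z \<le> indicator U z" "indicator U z = (0::real)"
          using f by (auto simp: K_def open_minorants_def)
        then show False using \<open>0 < e\<close> by simp
      qed
      ultimately have *: "emeasure ?L K \<le> (SUP K\<in>{K. compactin Z K \<and> K \<subseteq> U}. emeasure ?L K)"
        by (intro SUP_upper) auto
      \<comment> \<open>On \<open>K\<close> the bound follows from \<open>f \<le> 1\<close>, and off
        \<open>K\<close> from \<open>f < e\<close>. The constant contributes just \<open>e\<close>,
        since \<open>?L\<close> has mass one.\<close>
      have "(\<integral>\<^sup>+z. ennreal (f z) \<partial>?L) \<le> (\<integral>\<^sup>+z. indicator K z + ennreal e \<partial>?L)"
      proof (rule nn_integral_mono)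
        fix z assume "z \<in> space ?L"
        then have "z \<in> topspace Z" using sp by simp
        moreover have "indicator U z \<le> (1::real)" by (simp add: indicator_def)
        ultimately have "f z \<le> 1"
          using f order_trans unfolding open_minorants_def by blast
        then show "ennreal (f z) \<le> indicator K z + ennreal e"
          using \<open>z \<in> topspace Z\<close> \<open>0 < e\<close>
          by (cases "z \<in> K") (auto simp: K_def indicator_def intro!: ennreal_leI add_increasing2)
      qed
      also have "\<dots> = emeasure ?L K + ennreal e"
        using KL by (subst nn_integral_add) (auto simp: L.emeasure_space_1)
      also note add_right_mono[OF *]
      finally show "(\<integral>\<^sup>+z. ennreal (f z) \<partial>?L) \<le>
          (SUP K\<in>{K. compactin Z K \<and> K \<subseteq> U}. emeasure ?L K) + ennreal e" by simp
    qed
    finally show ?thesis .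
  qed
  then have "regular_measure Z ?L"
    using regular_measureI[OF assms(2,3) sets L.finite_measure_axioms] by blast
  then show ?thesis
    using sets L by (simp add: ProbMeas_def)
qed

section \<open>Iterated integrals of continuous functions\<close>

text \<open>Compactness bounds \<open>f\<close> by some \<open>B\<close> on
  \<open>topspace Z\<close>, and every \<open>\<nu> y\<close> with \<open>y\<close> in
  \<open>topspace Y\<close> has mass one; these are the bounds \<open>B\<close> and
  \<open>B'\<close> that \<open>integral_bind\<close> asks for.\<close>

lemma integral_bind_stochastic_map:
  fixes f :: "'c \<Rightarrow> real"
  assumes "compact_space Z" "Hausdorff_space Z" "stochastic_map Y Z \<nu>" "M \<in> ProbMeas Y"
    and "continuous_map Z euclideanreal f"
  shows "(\<integral>z. f z \<partial>(M \<bind> \<nu>)) = (\<integral>y. \<integral>z. f z \<partial>\<nu> y \<partial>M)"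
proof -
  note M = ProbMeasD[OF assms(4)]
  interpret prob_space M by fact
  note P = ProbMeasD[OF stochastic_map_ProbMeas[OF assms(3)]]
  obtain B where B: "\<And>z. z \<in> topspace Z \<Longrightarrow> \<bar>f z\<bar> \<le> B"
    using continuous_map_bounded_compact[OF assms(1,5)] by (auto simp: bounded_iff)
  show ?thesis
  proof (rule integral_bind[where K="borel_of Z" and B=B and B'=1])
    show "AE y in M. emeasure (\<nu> y) (space (\<nu> y)) \<le> ennreal 1"
      using P(2) M(4) by (intro AE_I2) (simp add: prob_space.emeasure_space_1)
  qed (use B assms stochastic_map_measurable' continuous_map_borel_measurable in
      \<open>auto intro: finite_measure_axioms\<close>)
qed

text \<open>The real case is applied to \<open>Re\<close> and \<open>Im\<close>. Moving them through
  the integrals needs integrability of \<open>\<phi>\<close> against the bind and each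
  \<open>\<nu> y\<close>, and of the inner integral against \<open>M\<close>; all three integrands
  are continuous on compact spaces.\<close>

lemma complex_integral_bind_stochastic_map:
  fixes \<phi> :: "'c \<Rightarrow> complex"
  assumes "compact_space Y" "Hausdorff_space Y" "compact_space Z" "Hausdorff_space Z"
    and \<nu>: "stochastic_map Y Z \<nu>" and M: "M \<in> ProbMeas Y"
    and \<phi>: "continuous_map Z euclidean \<phi>"
  shows "(\<integral>z. \<phi> z \<partial>(M \<bind> \<nu>)) = (\<integral>y. \<integral>z. \<phi> z \<partial>\<nu> y \<partial>M)"
proof -
  have ReIm: "continuous_map Z euclideanreal (\<lambda>z. Re (\<phi> z))"
    "continuous_map Z euclideanreal (\<lambda>z. Im (\<phi> z))"
    using continuous_map_compose[OF \<phi>, of euclidean Re] continuous_map_compose[OF \<phi>, of euclidean Im]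
    by (simp_all add: o_def continuous_map_iff_continuous2 continuous_intros)
  note L = integrable_continuous_map[OF assms(3) \<phi> bind_stochastic_map_ProbMeas[OF assms(2-4) \<nu> M]]
  note N = integrable_continuous_map[OF assms(3) \<phi> stochastic_map_ProbMeas[OF \<nu>]]
  note I = integrable_continuous_map[OF assms(1) stochastic_map_integral_continuous[OF \<nu> \<phi>] M]
  note bind = integral_bind_stochastic_map[OF assms(3,4) \<nu> M]
  have "Re (\<integral>z. \<phi> z \<partial>(M \<bind> \<nu>)) = (\<integral>y. Re (\<integral>z. \<phi> z \<partial>\<nu> y) \<partial>M)"
    unfolding integral_Re[OF L, symmetric] bind[OF ReIm(1)] using N ProbMeasD(4)[OF M]
    by (intro Bochner_Integration.integral_cong) simp_all
  moreover have "Im (\<integral>z. \<phi> z \<partial>(M \<bind> \<nu>)) = (\<integral>y. Im (\<integral>z. \<phi> z \<partial>\<nu> y) \<partial>M)"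
    unfolding integral_Im[OF L, symmetric] bind[OF ReIm(2)] using N ProbMeasD(4)[OF M]
    by (intro Bochner_Integration.integral_cong) simp_all
  ultimately show ?thesis
    by (simp add: complex_eq_iff integral_Re[OF I] integral_Im[OF I])
qed

section \<open>The composite as a bind, and its continuity\<close>

text \<open>The set function in \<open>stochastic_comp\<close> agrees on Borel sets with the measure
  of the bind, so \<open>measure_of\<close> rebuilds that measure and its zero default does not
  arise.\<close>

lemma stochastic_comp_eq_bind:
  assumes "compact_space Z" "Hausdorff_space Z"
    and \<nu>: "stochastic_map Y Z \<nu>" and M: "\<mu> x \<in> ProbMeas Y"
  shows "stochastic_comp Z \<nu> \<mu> x = \<mu> x \<bind> \<nu>"
proof -
  note M' = ProbMeasD[OF M]
  note P = ProbMeasD[OF stochastic_map_ProbMeas[OF \<nu>]]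
  interpret prob_space "\<mu> x" by fact
  have sets: "sets (\<mu> x \<bind> \<nu>) = sets (borel_of Z)"
    using P(1) M'(4) not_empty by (intro sets_bind) auto
  have space: "space (\<mu> x \<bind> \<nu>) = topspace Z"
    using sets_eq_imp_space_eq[OF sets] by simp
  have "stochastic_comp Z \<nu> \<mu> x =
      measure_of (topspace Z) (sets (borel_of Z)) (emeasure (\<mu> x \<bind> \<nu>))"
    unfolding stochastic_comp_def
  proof (rule measure_of_eq)
    show "sets (borel_of Z) \<subseteq> Pow (topspace Z)"
      using sets.space_closed[of "borel_of Z"] by simp
    fix E assume "E \<in> sigma_sets (topspace Z) (sets (borel_of Z))"
    then have "E \<in> sets (borel_of Z)"
      using sets.sigma_sets_eq[of "borel_of Z"] by simp
    then show "(\<integral>\<^sup>+y. emeasure (\<nu> y) E \<partial>\<mu> x) = emeasure (\<mu> x \<bind> \<nu>) E"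
      using emeasure_bind[OF not_empty stochastic_map_measurable'[OF assms(1,2) \<nu> M]] by simp
  qed
  then show ?thesis
    using measure_of_of_measure[of "\<mu> x \<bind> \<nu>"] by (simp add: sets space)
qed

text \<open>Continuity into a generated topology need only be checked on the subbase.\<close>

lemma stochastic_mapI:
  assumes "\<And>x. x \<in> topspace X \<Longrightarrow> \<mu> x \<in> ProbMeas Y"
    and "\<And>\<phi>. continuous_map Y (euclidean :: complex topology) \<phi> \<Longrightarrow>
      continuous_map X euclidean (\<lambda>x. \<integral>y. \<phi> y \<partial>\<mu> x)"
  shows "stochastic_map X Y \<mu>"
  unfolding stochastic_map_def vague_topology_def
proof (rule continuous_on_generated_topo)
  fix W assume "W \<in> {{M \<in> ProbMeas Y. (\<integral>y. \<phi> y \<partial>M) \<in> V} |\<phi> V.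
    continuous_map Y (euclidean :: complex topology) \<phi> \<and> open V}"
  then obtain \<phi> :: "'b \<Rightarrow> complex" and V where W: "W = {M \<in> ProbMeas Y. (\<integral>y. \<phi> y \<partial>M) \<in> V}"
    "continuous_map Y euclidean \<phi>" "open V"
    by blast
  have "\<mu> -` W \<inter> topspace X = {x \<in> topspace X. (\<integral>y. \<phi> y \<partial>\<mu> x) \<in> V}"
    using assms(1) W(1) by auto
  then show "openin X (\<mu> -` W \<inter> topspace X)"
    using assms(2)[OF W(2)] W(3) by (simp add: continuous_map_def)
next
  show "\<mu> ` topspace X \<subseteq> \<Union> {{M \<in> ProbMeas Y. (\<integral>y. \<phi> y \<partial>M) \<in> V} |\<phi> V.
    continuous_map Y (euclidean :: complex topology) \<phi> \<and> open V}"
    using assms(1) topspace_vague_topology[of Y]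
    unfolding vague_topology_def topology_generated_by_topspace by blast
qed

theorem proposition4p79:
  fixes X :: "'a topology" and Y :: "'b topology" and Z :: "'c topology"
    and \<mu> :: "'a \<Rightarrow> 'b measure" and \<nu> :: "'b \<Rightarrow> 'c measure"
  assumes "compact_space X" and "Hausdorff_space X"
    and "compact_space Y" and "Hausdorff_space Y"
    and "compact_space Z" and "Hausdorff_space Z"
    and "stochastic_map X Y \<mu>" and "stochastic_map Y Z \<nu>"
  shows "(\<forall>x\<in>topspace X.
            stochastic_comp Z \<nu> \<mu> x \<in> ProbMeas Z \<and>
            (\<forall>E\<in>sets (borel_of Z).
               emeasure (stochastic_comp Z \<nu> \<mu> x) E = (\<integral>\<^sup>+y. emeasure (\<nu> y) E \<partial>\<mu> x))) \<and>
         stochastic_map X Z (stochastic_comp Z \<nu> \<mu>)"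
proof -
  have M: "\<mu> x \<in> ProbMeas Y" if "x \<in> topspace X" for x
    using stochastic_map_ProbMeas[OF assms(7) that] .
  have eq: "stochastic_comp Z \<nu> \<mu> x = \<mu> x \<bind> \<nu>" if "x \<in> topspace X" for x
    using stochastic_comp_eq_bind[of Z Y \<nu> \<mu> x] assms(5,6,8) M[OF that] .
  have prob: "stochastic_comp Z \<nu> \<mu> x \<in> ProbMeas Z" if "x \<in> topspace X" for x
    using bind_stochastic_map_ProbMeas[OF assms(4-6,8) M[OF that]] eq[OF that] by simp
  have "emeasure (stochastic_comp Z \<nu> \<mu> x) E = (\<integral>\<^sup>+y. emeasure (\<nu> y) E \<partial>\<mu> x)"
    if x: "x \<in> topspace X" and E: "E \<in> sets (borel_of Z)" for x E
    unfolding eq[OF x]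
    using prob_space.not_empty[OF ProbMeasD(2)[OF M[OF x]]]
      stochastic_map_measurable'[OF assms(5,6,8) M[OF x]] E
    by (rule emeasure_bind)
  moreover have "stochastic_map X Z (stochastic_comp Z \<nu> \<mu>)"
  proof (rule stochastic_mapI[OF prob])
    fix \<phi> :: "'c \<Rightarrow> complex" assume \<phi>: "continuous_map Z euclidean \<phi>"
    \<comment> \<open>Continuity of \<open>\<nu>\<close> makes the inner integral a test function on
      \<open>Y\<close>, to which continuity of \<open>\<mu>\<close> applies.\<close>
    have "continuous_map X euclidean (\<lambda>x. \<integral>y. \<integral>z. \<phi> z \<partial>\<nu> y \<partial>\<mu> x)"
      by (intro stochastic_map_integral_continuous[OF assms(7)]
          stochastic_map_integral_continuous[OF assms(8)] \<phi>)
    \<comment> \<open>The two functions of \<open>x\<close> agree on \<open>topspace X\<close>,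
      which is all that continuity there depends on.\<close>
    then show "continuous_map X euclidean (\<lambda>x. \<integral>z. \<phi> z \<partial>stochastic_comp Z \<nu> \<mu> x)"
      using complex_integral_bind_stochastic_map[OF assms(3-6,8) M \<phi>] eq
      by (auto elim!: continuous_map_eq)
  qed
  ultimately show ?thesis using prob by blast
qed
end
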